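(* Let $k\ge 2$ and let $$P(t)=1+\sum_{n\ge1}\frac{p^{\binom n2}(-t)^n}{[n]_{p,q}!}[k]_{r^n},\quad G(t)=\sum_{n\ge2}(n-1)\frac{p^{\binom n2}(-t)^n}{[n]_{p,q}!}[k]_{r^n},\quad H(t)=-\sum_{n\ge3}\binom{n-1}{2}\frac{p^{\binom n2}(-t)^n}{[n]_{p,q}!}[k]_{r^n}.$$ Then $$\sum_{n\ge0}\frac{t^n}{[n]_{p,q}!}\sum_{(\sigma,w)\in\mathcal{U}_{n,k}}q^{\mathrm{inv}(\sigma)}p^{\mathrm{coinv}(\sigma)}r^{\|w\|}=\frac{([k]_rt-1)+P(t)-G(t)}{P(t)^2}$$ and $$\sum_{n\ge0}\frac{t^n}{[n]_{p,q}!}\sum_{(\sigma,w)\in\mathcal{V}_{n,k}}q^{\mathrm{inv}(\sigma)}p^{\mathrm{coinv}(\sigma)}r^{\|w\|}=\frac{G(t)^2+P(t)\big(H(t)+G(t)-([k]_rt-1)-P(t)\big)}{P(t)^3}.$$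
   Context: $C_k\wr S_n$ is identified with the set of pairs $(\sigma,w)$, $\sigma\in S_n$, $w=w_1\cdots w_n\in\{0,\dots,k-1\}^n$. The weak rise set is $\mathrm{WRis}(\sigma,w)=\{i\le n-1:\sigma_i<\sigma_{i+1},\ w_i= w_{i+1}\}$. $\mathcal{U}_{n,k}$ is the set of $(\sigma,w)\in C_k\wr S_n$ with $\mathrm{WRis}(\sigma,w)=\{s,s+1\}$ for some $1\le s\le n-2$; $\mathcal{V}_{n,k}$ is the set of $(\sigma,w)\in C_k\wr S_n$ with $\mathrm{WRis}(\sigma,w)=\{i,j\}$ for some $i+2\le j$. $\mathrm{inv}(\sigma)=|\{a<b:\sigma_a>\sigma_b\}|$, $\mathrm{coinv}(\sigma)=|\{a<b:\sigma_a<\sigma_b\}|$, $\|w\|=w_1+\cdots+w_n$. $[n]_{p,q}=p^{n-1}+\cdots+q^{n-1}$, $[n]_{p,q}!=[n]_{p,q}\cdots[1]_{p,q}$; $[k]_r=1+r+\cdots+r^{k-1}$, $[k]_{r^n}=1+r^n+\cdots+r^{(k-1)n}$. *)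

theory Defs
  imports
    "HOL-Computational_Algebra.Computational_Algebra"
    "HOL-Combinatorics.Permutations"
    "HOL-Library.FuncSet"
begin

definition pq_num :: "'a::comm_ring_1 \<Rightarrow> 'a \<Rightarrow> nat \<Rightarrow> 'a" where
  "pq_num p q n = (\<Sum>i<n. p ^ (n - 1 - i) * q ^ i)"

definition pq_fact :: "'a::comm_ring_1 \<Rightarrow> 'a \<Rightarrow> nat \<Rightarrow> 'a" where
  "pq_fact p q n = (\<Prod>m=1..n. pq_num p q m)"

definition r_num :: "nat \<Rightarrow> 'a::comm_ring_1 \<Rightarrow> 'a" where
  "r_num k x = (\<Sum>i<k. x ^ i)"

(* Extensional functions make words of length n correspond to functions one to one,
   as "permutes" does for permutations, so that sums over wreath n k count each pair once. *)
definition wreath :: "nat \<Rightarrow> nat \<Rightarrow> ((nat \<Rightarrow> nat) \<times> (nat \<Rightarrow> nat)) set" where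
  "wreath n k = {\<sigma>. \<sigma> permutes {1..n}} \<times> ({1..n} \<rightarrow>\<^sub>E {0..<k})"

definition WRis :: "nat \<Rightarrow> (nat \<Rightarrow> nat) \<Rightarrow> (nat \<Rightarrow> nat) \<Rightarrow> nat set" where
  "WRis n \<sigma> w = {i \<in> {1..<n}. \<sigma> i < \<sigma> (i + 1) \<and> w i = w (i + 1)}"

definition U_set :: "nat \<Rightarrow> nat \<Rightarrow> ((nat \<Rightarrow> nat) \<times> (nat \<Rightarrow> nat)) set" where
  "U_set n k = {(\<sigma>, w) \<in> wreath n k. \<exists>s. 1 \<le> s \<and> s + 2 \<le> n \<and> WRis n \<sigma> w = {s, s + 1}}"

definition V_set :: "nat \<Rightarrow> nat \<Rightarrow> ((nat \<Rightarrow> nat) \<times> (nat \<Rightarrow> nat)) set" where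
  "V_set n k = {(\<sigma>, w) \<in> wreath n k. \<exists>i j. i + 2 \<le> j \<and> WRis n \<sigma> w = {i, j}}"

definition inv_stat :: "nat \<Rightarrow> (nat \<Rightarrow> nat) \<Rightarrow> nat" where
  "inv_stat n \<sigma> = card {(a, b). a \<in> {1..n} \<and> b \<in> {1..n} \<and> a < b \<and> \<sigma> a > \<sigma> b}"

definition coinv_stat :: "nat \<Rightarrow> (nat \<Rightarrow> nat) \<Rightarrow> nat" where
  "coinv_stat n \<sigma> = card {(a, b). a \<in> {1..n} \<and> b \<in> {1..n} \<and> a < b \<and> \<sigma> a < \<sigma> b}"

definition word_norm :: "nat \<Rightarrow> (nat \<Rightarrow> nat) \<Rightarrow> nat" where
  "word_norm n w = (\<Sum>i=1..n. w i)"

definition gen_fun ::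
    "'a::field \<Rightarrow> 'a \<Rightarrow> 'a \<Rightarrow> (nat \<Rightarrow> ((nat \<Rightarrow> nat) \<times> (nat \<Rightarrow> nat)) set) \<Rightarrow> 'a fps" where
  "gen_fun p q r A = Abs_fps (\<lambda>n. (\<Sum>(\<sigma>, w)\<in>A n.
      q ^ inv_stat n \<sigma> * p ^ coinv_stat n \<sigma> * r ^ word_norm n w) / pq_fact p q n)"

(* coefficient of t^n in p^(n choose 2) (-t)^n [k]_{r^n} / [n]_{p,q}! *)
definition base_coeff :: "'a::field \<Rightarrow> 'a \<Rightarrow> 'a \<Rightarrow> nat \<Rightarrow> nat \<Rightarrow> 'a" where
  "base_coeff p q r k n = p ^ (n choose 2) * (- 1) ^ n / pq_fact p q n * r_num k (r ^ n)"

definition P_ser :: "'a::field \<Rightarrow> 'a \<Rightarrow> 'a \<Rightarrow> nat \<Rightarrow> 'a fps" where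
  "P_ser p q r k = 1 + Abs_fps (\<lambda>n. if n \<ge> 1 then base_coeff p q r k n else 0)"

definition G_ser :: "'a::field \<Rightarrow> 'a \<Rightarrow> 'a \<Rightarrow> nat \<Rightarrow> 'a fps" where
  "G_ser p q r k = Abs_fps (\<lambda>n. if n \<ge> 2 then of_nat (n - 1) * base_coeff p q r k n else 0)"

definition H_ser :: "'a::field \<Rightarrow> 'a \<Rightarrow> 'a \<Rightarrow> nat \<Rightarrow> 'a fps" where
  "H_ser p q r k =
     - Abs_fps (\<lambda>n. if n \<ge> 3 then of_nat ((n - 1) choose 2) * base_coeff p q r k n else 0)"

(* The condition that no [n]_{p,q} vanishes is what makes the series above meaningful.
   It holds when p, q, r are independent indeterminates, i.e. the three variables in the
   fraction field of Z[r][q][p], and for positive real p and q. *)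
lemma pq_num_to_fract: "pq_num (to_fract a) (to_fract b) n = to_fract (pq_num a b n)"
proof -
  have pow: "to_fract x ^ m = to_fract (x ^ m)" for x :: 'a and m
    by (induction m) simp_all
  have sum: "(\<Sum>i\<in>A. to_fract (f i)) = to_fract (sum f A)" for f :: "nat \<Rightarrow> 'a" and A
    by (induction A rule: infinite_finite_induct) simp_all
  show ?thesis
    by (simp add: pq_num_def pow flip: to_fract_mult sum)
qed

lemma pq_num_indeterminates_nonzero:
  fixes p q :: "int poly poly poly fract"
  assumes "p = to_fract [:0, 1:]" and "q = to_fract [:[:0, 1:]:]" and "n \<ge> 1"
  shows "pq_num p q n \<noteq> 0"
proof -
  let ?p = "[:0, 1:] :: int poly poly poly" and ?q = "[:[:0, 1:]:] :: int poly poly poly"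
  have "poly (pq_num ?p ?q n) 0 = (\<Sum>i<n. 0 ^ (n - 1 - i) * [:0, 1:] ^ i)"
    by (simp add: pq_num_def poly_sum)
  also have "\<dots> = (\<Sum>i<n. if i = n - 1 then [:0, 1:] ^ i else 0)"
    by (rule sum.cong) (auto simp: power_0_left)
  also have "\<dots> = [:0, 1:] ^ (n - 1)"
    using assms(3) by simp
  also have "\<dots> \<noteq> 0"
    by simp
  finally have "pq_num ?p ?q n \<noteq> 0"
    by auto
  then show ?thesis
    by (simp add: assms pq_num_to_fract)
qed

lemma pq_num_real_pos:
  fixes p q :: real
  assumes "p > 0" and "q > 0" and "n \<ge> 1"
  shows "pq_num p q n \<noteq> 0"
proof -
  have "pq_num p q n > 0"
    unfolding pq_num_def using assms by (intro sum_pos) (auto simp: lessThan_empty_iff)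
  then show ?thesis by simp
qed

end

theory Submission
  imports Defs
begin

text \<open>
  A pair $(\sigma, w)$ is read as the word of the letters $(\sigma_i, w_i)$. For functions
  $\Phi, \Psi$ on words that depend only on the relative order of the values and on the colors,
  the series $\sum_n t^n/[n]_{p,q}! \sum_{(\sigma,w)} q^{inv} p^{coinv} r^{|w|} \Phi$ is
  multiplicative: the product corresponds to $\sum \Phi(u) \Psi(v)$ over all factorizations $uv$
  of the word. This is the $p,q$-binomial theorem applied to the set of values in $u$.

  Functions supported on runs (increasing values, constant color) have explicit series, and
  $P$, $G$, $H$ arise from the run weights \<open>altc\<close>, \<open>gc\<close>, \<open>hc\<close>. If $N$, $R$, $T$
  are the indicators of words with 0, 1, 2 weak rises and $U$ that of words with exactly two weak
  rises, which are adjacent, then removing an initial run gives $P N = 1$, $P R = G N$,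
  $P T = G R + H N$ and $P U = ([k]_r t - 1 + P - G) N$, each checked word by word by induction
  on the first letter. The series for $V$ is $T - U$.
\<close>

section \<open>Words and runs\<close>

definition rise :: "nat \<times> nat \<Rightarrow> nat \<times> nat \<Rightarrow> bool" where
  "rise a b \<longleftrightarrow> fst a < fst b \<and> snd a = snd b"

definition rises :: "(nat \<times> nat) list \<Rightarrow> nat set" where
  "rises l = {i. Suc i < length l \<and> rise (l ! i) (l ! Suc i)}"

lemma rises_Nil [simp]: "rises [] = {}"
  by (simp add: rises_def)

lemma rises_Cons:
  "rises (a # m) = (if m \<noteq> [] \<and> rise a (hd m) then {0} else {}) \<union> Suc ` rises m"
proof -
  have "i \<in> rises (a # m) \<longleftrightarrow>
      i \<in> (if m \<noteq> [] \<and> rise a (hd m) then {0} else {}) \<union> Suc ` rises m" for i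
    by (cases i) (auto simp: rises_def hd_conv_nth)
  then show ?thesis by blast
qed

lemma finite_rises [simp]: "finite (rises l)"
  by (rule finite_subset[of _ "{..<length l}"]) (auto simp: rises_def)

lemma card_rises_Cons:
  "card (rises (a # m)) = (if m \<noteq> [] \<and> rise a (hd m) then Suc (card (rises m)) else card (rises m))"
proof -
  have "card (insert 0 (Suc ` rises m)) = Suc (card (rises m))"
    by (subst card_insert_disjoint) (auto simp: card_image)
  then show ?thesis by (simp add: rises_Cons card_image)
qed

lemma rises_map_apfst:
  assumes "strict_mono_on (fst ` set l) f"
  shows "rises (map (apfst f) l) = rises l"
proof -
  have "f (fst (l ! i)) < f (fst (l ! Suc i)) \<longleftrightarrow> fst (l ! i) < fst (l ! Suc i)"
    if "Suc i < length l" for i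
    using that by (intro strict_mono_on_less[OF assms]) auto
  then show ?thesis
    by (auto simp: rises_def rise_def)
qed

text \<open>Monotonicity is asked only on the values that occur, because the relabellings used later
  are order isomorphisms between finite sets.\<close>

definition order_invariant :: "((nat \<times> nat) list \<Rightarrow> 'a) \<Rightarrow> bool" where
  "order_invariant \<Phi> \<longleftrightarrow>
     (\<forall>f l. strict_mono_on (fst ` set l) f \<longrightarrow> \<Phi> (map (apfst f) l) = \<Phi> l)"

lemma order_invariant_rises: "order_invariant (\<lambda>l. \<phi> (rises l))"
  by (simp add: order_invariant_def rises_map_apfst)

text \<open>As \<open>rise\<close> is transitive, the condition says that consecutive letters rise;
  the empty word and single letters count as runs.\<close>

definition run_wt :: "(nat \<Rightarrow> 'a::comm_ring_1) \<Rightarrow> (nat \<times> nat) list \<Rightarrow> 'a" where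
  "run_wt c l = (if sorted_wrt rise l then c (length l) else 0)"

lemma order_invariant_run_wt: "order_invariant (run_wt c)"
proof -
  have "sorted_wrt rise (map (apfst f) l) \<longleftrightarrow> sorted_wrt rise l"
    if "strict_mono_on (fst ` set l) f" for f and l :: "(nat \<times> nat) list"
  proof -
    have "sorted_wrt (\<lambda>x y. rise (apfst f x) (apfst f y)) l \<longleftrightarrow> sorted_wrt rise l"
    proof (intro iffI; erule sorted_wrt_mono_rel[rotated])
      fix x y assume "x \<in> set l" "y \<in> set l"
      then have "f (fst x) < f (fst y) \<longleftrightarrow> fst x < fst y"
        by (intro strict_mono_on_less[OF that]) auto
      then show "rise x y \<Longrightarrow> rise (apfst f x) (apfst f y)" "rise (apfst f x) (apfst f y) \<Longrightarrow> rise x y"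
        by (simp_all add: rise_def)
    qed
    then show ?thesis by (simp add: sorted_wrt_map)
  qed
  then show ?thesis by (simp add: order_invariant_def run_wt_def)
qed

section \<open>Sums over factorizations of a word with a run as prefix\<close>

definition conv :: "((nat \<times> nat) list \<Rightarrow> 'a::comm_ring_1) \<Rightarrow> ((nat \<times> nat) list \<Rightarrow> 'a) \<Rightarrow>
    (nat \<times> nat) list \<Rightarrow> 'a" where
  "conv \<Phi> \<Psi> l = (\<Sum>i\<le>length l. \<Phi> (take i l) * \<Psi> (drop i l))"

lemma conv_Nil [simp]: "conv \<Phi> \<Psi> [] = \<Phi> [] * \<Psi> []"
  by (simp add: conv_def)

lemma conv_Cons: "conv \<Phi> \<Psi> (a # m) = \<Phi> [] * \<Psi> (a # m) + conv (\<lambda>l. \<Phi> (a # l)) \<Psi> m"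
  by (simp add: conv_def sum.atMost_Suc_shift del: sum.atMost_Suc)

lemma transp_rise: "transp rise"
  by (auto simp: transp_def rise_def)

lemma run_wt_Nil [simp]: "run_wt c [] = c 0"
  by (simp add: run_wt_def)

text \<open>The first summand is the empty prefix. If \<open>a\<close> rises into \<open>m\<close>,
  a prefix of \<open>m\<close> is a run exactly when it remains one with \<open>a\<close> in front,
  so only the length shifts. Otherwise \<open>[a]\<close> is the only nonempty run prefix.\<close>

lemma conv_run_wt_Cons:
  "conv (run_wt c) \<Psi> (a # m) = c 0 * \<Psi> (a # m) +
     (if m \<noteq> [] \<and> rise a (hd m) then conv (run_wt (\<lambda>n. c (Suc n))) \<Psi> m else c 1 * \<Psi> m)"
proof (cases m)
  case Nil
  then show ?thesis by (simp add: conv_Cons run_wt_def)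
next
  case (Cons b m')
  have "run_wt c (a # b # l) = (if rise a b then run_wt (\<lambda>n. c (Suc n)) (b # l) else 0)" for l
    by (simp add: run_wt_def sorted_wrt2[OF transp_rise] del: sorted_wrt.simps)
  then show ?thesis
    by (simp add: Cons conv_Cons) (simp add: conv_def run_wt_def)
qed

lemma conv_run_wt_add:
  "conv (run_wt (\<lambda>n. c n + d n)) \<Psi> l = conv (run_wt c) \<Psi> l + conv (run_wt d) \<Psi> l"
  by (auto simp: conv_def run_wt_def sum.distrib[symmetric] algebra_simps intro!: sum.cong)

lemma conv_run_wt_uminus: "conv (run_wt (\<lambda>n. - c n)) \<Psi> l = - conv (run_wt c) \<Psi> l"
  by (auto simp: conv_def run_wt_def sum_negf[symmetric] intro!: sum.cong)

lemma conv_run_wt_delta: "conv (run_wt (\<lambda>n. if n = 0 then 1 else 0)) \<Psi> l = \<Psi> l"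
proof -
  have "conv (run_wt (\<lambda>n. 0)) \<Psi> m = 0" for m
    by (simp add: conv_def run_wt_def)
  then show ?thesis
    by (cases l) (simp_all add: conv_run_wt_Cons)
qed

text \<open>
  Expanding $(x - 1)^{n-1}$ in powers of $x$, where $x$ marks weak rises, the coefficients of
  $x^0$, $x^1$, $x^2$ are \<open>- altc n\<close>, \<open>gc n\<close> and \<open>hc n\<close>. The weight \<open>uc n\<close>
  carries the sign $(-1)^{n-3}$ times the number of ways to mark two adjacent rises in a run of
  length \<open>n\<close>. The truncated subtractions make the values at \<open>n = 0\<close> the right ones.
\<close>

definition altc :: "nat \<Rightarrow> 'a::comm_ring_1" where "altc n = (- 1) ^ n"

definition gc :: "nat \<Rightarrow> 'a::comm_ring_1" where "gc n = of_nat (n - 1) * (- 1) ^ n"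

definition hc :: "nat \<Rightarrow> 'a::comm_ring_1" where "hc n = - (of_nat ((n - 1) choose 2) * (- 1) ^ n)"

definition uc :: "nat \<Rightarrow> 'a::comm_ring_1" where "uc n = - (of_nat (n - 2) * (- 1) ^ n)"

section \<open>Rise indicators and their convolution identities\<close>

definition rises_ind :: "nat \<Rightarrow> (nat \<times> nat) list \<Rightarrow> 'a::comm_ring_1" where
  "rises_ind j l = of_bool (card (rises l) = j)"

definition adj_ind :: "(nat \<times> nat) list \<Rightarrow> 'a::comm_ring_1" where
  "adj_ind l = of_bool (\<exists>s. rises l = {s, Suc s})"

lemma rises_ind_Nil [simp]: "rises_ind j [] = of_bool (j = 0)"
  by (auto simp: rises_ind_def)

lemma rises_ind_Cons:
  "rises_ind j (a # m) = (if m \<noteq> [] \<and> rise a (hd m)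
     then (if j = 0 then 0 else rises_ind (j - 1) m) else rises_ind j m)"
  by (cases j) (auto simp: rises_ind_def card_rises_Cons)

lemma conv_altc_Suc: "conv (run_wt (\<lambda>n. altc (Suc n))) \<Psi> l = - conv (run_wt altc) \<Psi> l"
proof -
  have "altc (Suc n) = (- altc n :: 'a)" for n
    by (simp add: altc_def)
  then show ?thesis by (simp add: conv_run_wt_uminus)
qed

text \<open>The summand \<open>\<Psi> l\<close> comes from a delta at 0: there
  \<open>- gc 0 - altc 0\<close> is -1, while \<open>gc 1\<close> is 0.\<close>

lemma conv_gc_Suc:
  "conv (run_wt (\<lambda>n. gc (Suc n))) \<Psi> l = \<Psi> l - conv (run_wt gc) \<Psi> l - conv (run_wt altc) \<Psi> l"
proof -
  have "gc (Suc n) = (if n = 0 then 1 else 0) + (- gc n + - altc n :: 'a)" for n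
    by (cases n) (auto simp: gc_def altc_def algebra_simps)
  then show ?thesis
    by (simp only: conv_run_wt_add conv_run_wt_uminus conv_run_wt_delta) simp
qed

text \<open>This is Pascal's rule for \<open>n choose 2\<close>, with signs.\<close>

lemma conv_hc_Suc:
  "conv (run_wt (\<lambda>n. hc (Suc n))) \<Psi> l = conv (run_wt gc) \<Psi> l - conv (run_wt hc) \<Psi> l"
proof -
  have "hc (Suc n) = gc n + (- hc n :: 'a)" for n
    by (cases n) (auto simp: gc_def hc_def numeral_2_eq_2 algebra_simps)
  then show ?thesis
    by (simp only: conv_run_wt_add conv_run_wt_uminus) simp
qed

lemma conv_uc_Suc: "conv (run_wt (\<lambda>n. uc (Suc n))) \<Psi> l = conv (run_wt gc) \<Psi> l"
proof -
  have "uc (Suc n) = (gc n :: 'a)" for n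
    by (simp add: uc_def gc_def)
  then show ?thesis by simp
qed

lemma uc_values [simp]: "uc 0 = 0" "uc (Suc 0) = 0"
  and gc_values [simp]: "gc 0 = 0" "gc (Suc 0) = 0"
  and hc_values [simp]: "hc 0 = 0" "hc (Suc 0) = 0"
  and altc_values [simp]: "altc 0 = 1" "altc (Suc 0) = - 1"
  by (simp_all add: uc_def gc_def hc_def altc_def binomial_eq_0)

text \<open>Without an initial rise, the empty and the one-letter prefix cancel. With one, the empty
  prefix contributes 0 and the rest is minus the sum for the nonempty tail, which vanishes by
  induction.\<close>

lemma conv_altc_ind_0: "conv (run_wt altc) (rises_ind 0) l = (if l = [] then 1 else 0)"
proof (induction l)
  case (Cons a m)
  then show ?case
    by (auto simp: conv_run_wt_Cons conv_altc_Suc rises_ind_Cons)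
qed simp

lemma conv_altc_ind_1: "conv (run_wt altc) (rises_ind (Suc 0)) l = conv (run_wt gc) (rises_ind 0) l"
proof (induction l)
  case (Cons a m)
  then show ?case
    by (auto simp: conv_run_wt_Cons conv_altc_Suc conv_gc_Suc conv_altc_ind_0
        rises_ind_Cons)
qed simp

text \<open>After an initial rise, the shift rules for \<open>gc\<close> and \<open>hc\<close>
  leave, besides the induction hypothesis, the difference of the two sides of
  \<open>conv_altc_ind_1\<close>.\<close>

lemma conv_altc_ind_2:
  "conv (run_wt altc) (rises_ind 2) l =
     conv (run_wt gc) (rises_ind (Suc 0)) l + conv (run_wt hc) (rises_ind 0) l"
proof (induction l)
  case (Cons a m)
  then show ?case
    by (auto simp: conv_run_wt_Cons conv_altc_Suc conv_gc_Suc conv_hc_Suc conv_altc_ind_1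
        rises_ind_Cons)
qed simp

lemma image_Suc_eq_pair: "Suc ` A = {s, Suc s} \<longleftrightarrow> (\<exists>t. s = Suc t \<and> A = {t, Suc t})"
proof
  assume A: "Suc ` A = {s, Suc s}"
  then obtain t where "s = Suc t" by auto
  then have "Suc ` A = Suc ` {t, Suc t}" using A by simp
  then have "A = {t, Suc t}" by (simp only: inj_image_eq_iff[OF inj_Suc])
  then show "\<exists>t. s = Suc t \<and> A = {t, Suc t}" using \<open>s = Suc t\<close> by blast
qed auto

lemma insert_0_image_Suc_eq_pair: "insert 0 (Suc ` A) = {s, Suc s} \<longleftrightarrow> s = 0 \<and> A = {0}"
  by (auto simp: set_eq_iff image_iff) (metis nat.inject nat.distinct(1))+

text \<open>If position 0 is a rise, the two adjacent rises must be 0 and 1, so \<open>m\<close> has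
  its only rise at its start. Such \<open>m\<close> are the words with rise-free tail that are not
  rise-free themselves, hence the difference.\<close>

lemma adj_ind_Cons:
  "adj_ind (a # m) = (if m \<noteq> [] \<and> rise a (hd m)
     then rises_ind 0 (tl m) - rises_ind 0 m else adj_ind m)"
proof (cases "m \<noteq> [] \<and> rise a (hd m)")
  case False
  then have "adj_ind (a # m) = adj_ind m"
    by (auto simp: adj_ind_def rises_Cons image_Suc_eq_pair)
  with False show ?thesis by (simp only: if_False)
next
  case True
  then obtain b m' where m: "m = b # m'" by (cases m) auto
  have "rises m = {0} \<longleftrightarrow> rises m' = {} \<and> rises m \<noteq> {}"
    by (auto simp: m rises_Cons)
  moreover have "rises m = {} \<longrightarrow> rises m' = {}"
    by (auto simp: m rises_Cons)
  ultimately show ?thesis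
    using True by (auto simp: adj_ind_def rises_ind_def m rises_Cons[of a]
      insert_0_image_Suc_eq_pair)
qed

lemma conv_altc_adj_ind: "conv (run_wt altc) adj_ind l = conv (run_wt uc) (rises_ind 0) l"
proof (induction l)
  case (Cons a m)
  show ?case
  proof (cases m)
    case (Cons b m')
    let ?N = "rises_ind 0 :: _ \<Rightarrow> 'a"
    \<comment> \<open>After an initial rise the induction hypothesis reduces the claim to evaluating
      the convolution with \<open>uc + gc\<close>. This weight is \<open>altc\<close> except at
      lengths 0 and 1, where both \<open>uc\<close> and \<open>gc\<close> vanish.\<close>
    have "uc n + gc n = altc n + ((if n = Suc 0 then 1 else 0) + - (if n = 0 then 1 else 0 :: 'a))"
      for n :: nat
      by (cases n; cases "n - 1") (auto simp: uc_def gc_def altc_def algebra_simps)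
    then have "conv (run_wt (\<lambda>n. uc n + gc n)) ?N m =
        conv (run_wt altc) ?N m - ?N m + conv (run_wt (\<lambda>n. if n = Suc 0 then 1 else 0)) ?N m"
      by (simp only: conv_run_wt_add conv_run_wt_uminus conv_run_wt_delta)
        (simp add: algebra_simps)
    \<comment> \<open>The \<open>altc\<close> term vanishes because \<open>m\<close> is nonempty,
      and the delta at length 1 strips the first letter \<open>b\<close>.\<close>
    also have "\<dots> = ?N m' - ?N m"
      by (simp add: Cons conv_run_wt_Cons[of "\<lambda>n. if n = Suc 0 then 1 else 0"] conv_altc_ind_0
          conv_run_wt_delta)
    finally have "?N m' - ?N m = conv (run_wt uc) ?N m + conv (run_wt gc) ?N m"
      by (simp add: conv_run_wt_add)
    then show ?thesis
      using Cons.IH by (simp add: conv_run_wt_Cons[of _ _ a] conv_altc_Suc conv_uc_Suc adj_ind_Cons Cons)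
  qed (simp add: conv_run_wt_Cons adj_ind_Cons)
qed (simp add: adj_ind_def)

section \<open>The $p,q$-binomial theorem\<close>

text \<open>Of the \<open>a + b\<close> monomials, those with exponent of \<open>q\<close> below
  \<open>b\<close> share the factor \<open>p ^ a\<close>, the others share
  \<open>q ^ b\<close>.\<close>

lemma pq_num_add: "pq_num p q (a + b) = q ^ b * pq_num p q a + p ^ a * pq_num p q b"
proof -
  have "pq_num p q (a + b) = (\<Sum>i<b + a. p ^ (a + b - 1 - i) * q ^ i)"
    by (simp add: pq_num_def add.commute)
  also have "{..<b + a} = {..<b} \<union> (\<lambda>i. b + i) ` {..<a}"
  proof (intro equalityI subsetI)
    fix i assume "i \<in> {..<b + a}"
    moreover have "i = b + (i - b)" if "\<not> i < b" using that by simp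
    ultimately show "i \<in> {..<b} \<union> (\<lambda>i. b + i) ` {..<a}"
      by (cases "i < b") (auto intro!: image_eqI[of _ _ "i - b"])
  qed auto
  also have "(\<Sum>i\<in>\<dots>. p ^ (a + b - 1 - i) * q ^ i) = (\<Sum>i<b. p ^ (a + b - 1 - i) * q ^ i) +
      (\<Sum>i<a. p ^ (a + b - 1 - (b + i)) * q ^ (b + i))"
    by (subst sum.union_disjoint) (auto simp: sum.reindex)
  also have "(\<Sum>i<b. p ^ (a + b - 1 - i) * q ^ i) = p ^ a * pq_num p q b"
    unfolding pq_num_def sum_distrib_left
    by (intro sum.cong) (auto simp: mult.assoc[symmetric] power_add[symmetric])
  also have "(\<Sum>i<a. p ^ (a + b - 1 - (b + i)) * q ^ (b + i)) = q ^ b * pq_num p q a"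
    unfolding pq_num_def sum_distrib_left
    by (intro sum.cong) (auto simp: power_add algebra_simps)
  finally show ?thesis by simp
qed

lemma pq_fact_0 [simp]: "pq_fact p q 0 = 1"
  by (simp add: pq_fact_def)

lemma pq_fact_Suc: "pq_fact p q (Suc n) = pq_num p q (Suc n) * pq_fact p q n"
  by (simp add: pq_fact_def mult.commute)

text \<open>Here \<open>x\<close> is the value that stands earlier in the word, so \<open>q\<close>
  marks an inversion.\<close>

definition pair_wt :: "'a::comm_ring_1 \<Rightarrow> 'a \<Rightarrow> nat \<Rightarrow> nat \<Rightarrow> 'a" where
  "pair_wt p q x y = (if y < x then q else p)"

definition cross_wt :: "'a::comm_ring_1 \<Rightarrow> 'a \<Rightarrow> nat set \<Rightarrow> nat set \<Rightarrow> 'a" where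
  "cross_wt p q Y Z = (\<Prod>y\<in>Y. \<Prod>z\<in>Z. pair_wt p q y z)"

lemma cross_wt_insert_right:
  assumes "finite Z" "Y \<subseteq> {..<n}" "n \<notin> Z"
  shows "cross_wt p q Y (insert n Z) = p ^ card Y * cross_wt p q Y Z"
proof -
  have "pair_wt p q y n = p" if "y \<in> Y" for y
    using that assms by (auto simp: pair_wt_def)
  then show ?thesis
    using assms by (simp add: cross_wt_def prod.distrib)
qed

lemma cross_wt_insert_left:
  assumes "finite Y" "Z \<subseteq> {..<n}" "n \<notin> Y"
  shows "cross_wt p q (insert n Y) Z = q ^ card Z * cross_wt p q Y Z"
proof -
  have "pair_wt p q n z = q" if "z \<in> Z" for z
    using that assms by (auto simp: pair_wt_def)
  then show ?thesis
    using assms by (simp add: cross_wt_def)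
qed

text \<open>The p,q-binomial coefficient in its subset form: \<open>Y\<close> is the set of values
  in a prefix of length \<open>i\<close>. The form needs no division.\<close>

definition pq_binom :: "'a::comm_ring_1 \<Rightarrow> 'a \<Rightarrow> nat \<Rightarrow> nat \<Rightarrow> 'a" where
  "pq_binom p q n i = (\<Sum>Y | Y \<subseteq> {..<n} \<and> card Y = i. cross_wt p q Y ({..<n} - Y))"

lemma pq_binom_0 [simp]: "pq_binom p q n 0 = 1"
proof -
  have "{Y. Y \<subseteq> {..<n} \<and> card Y = 0} = {{}}"
    by (auto dest: finite_subset[OF _ finite_lessThan])
  then show ?thesis by (simp add: pq_binom_def cross_wt_def)
qed

lemma pq_binom_eq_0: "n < i \<Longrightarrow> pq_binom p q n i = 0"
proof -
  assume "n < i"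
  moreover have "card Y \<le> n" if "Y \<subseteq> {..<n}" for Y
    using card_mono[OF finite_lessThan that] by simp
  ultimately have "{Y. Y \<subseteq> {..<n} \<and> card Y = i} = {}"
    by (auto simp: not_le[symmetric])
  then show ?thesis by (simp only: pq_binom_def) simp
qed

text \<open>Split by the place of the largest value \<open>n\<close>: in \<open>Y\<close> it forms
  an inversion with each of the \<open>n - i\<close> values of the complement; outside
  \<open>Y\<close> it forms a coinversion with each of the \<open>Suc i\<close> values of
  \<open>Y\<close>.\<close>

lemma pq_binom_Suc_Suc:
  "pq_binom p q (Suc n) (Suc i) =
     q ^ (n - i) * pq_binom p q n i + p ^ Suc i * pq_binom p q n (Suc i)"
proof -
  let ?S = "\<lambda>i. {Y. Y \<subseteq> {..<n} \<and> card Y = i}"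
  have fin: "finite Y" if "Y \<subseteq> {..<n}" for Y
    using that finite_subset by blast
  have fS: "finite (?S j)" for j
    by (rule finite_subset[of _ "Pow {..<n}"]) auto
  have split: "{Y. Y \<subseteq> {..<Suc n} \<and> card Y = Suc i} = insert n ` ?S i \<union> ?S (Suc i)"
  proof (intro equalityI subsetI)
    fix Y assume Y: "Y \<in> {Y. Y \<subseteq> {..<Suc n} \<and> card Y = Suc i}"
    show "Y \<in> insert n ` ?S i \<union> ?S (Suc i)"
    proof (cases "n \<in> Y")
      case True
      then have "Y - {n} \<in> ?S i" "Y = insert n (Y - {n})"
        using Y by (auto simp: less_Suc_eq)
      then show ?thesis by blast
    next
      case False
      then show ?thesis using Y by (auto simp: less_Suc_eq)
    qed
  next
    fix Y assume "Y \<in> insert n ` ?S i \<union> ?S (Suc i)"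
    then show "Y \<in> {Y. Y \<subseteq> {..<Suc n} \<and> card Y = Suc i}"
    proof
      assume "Y \<in> insert n ` ?S i"
      then obtain Z where Z: "Z \<subseteq> {..<n}" "card Z = i" "Y = insert n Z" by auto
      then have "n \<notin> Z" by auto
      with Z fin[of Z] show ?thesis by (auto simp: less_Suc_eq)
    qed (auto simp: less_Suc_eq)
  qed
  have inj: "inj_on (insert n) (?S i)"
    by (rule inj_onI) (metis (mono_tags, lifting) insert_ident lessThan_iff less_irrefl mem_Collect_eq subsetD)
  have "pq_binom p q (Suc n) (Suc i) =
      (\<Sum>Y\<in>insert n ` ?S i. cross_wt p q Y ({..<Suc n} - Y)) +
      (\<Sum>Y\<in>?S (Suc i). cross_wt p q Y ({..<Suc n} - Y))"
    unfolding pq_binom_def split by (intro sum.union_disjoint) (auto simp: fS)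
  also have "(\<Sum>Y\<in>insert n ` ?S i. cross_wt p q Y ({..<Suc n} - Y)) =
      (\<Sum>Y\<in>?S i. q ^ (n - i) * cross_wt p q Y ({..<n} - Y))"
  proof (subst sum.reindex[OF inj], intro sum.cong refl)
    fix Y assume Y: "Y \<in> ?S i"
    then have "{..<Suc n} - insert n Y = {..<n} - Y" "n \<notin> Y"
      by (auto simp: less_Suc_eq)
    then show "((\<lambda>Y. cross_wt p q Y ({..<Suc n} - Y)) \<circ> insert n) Y =
        q ^ (n - i) * cross_wt p q Y ({..<n} - Y)"
      using Y fin[of Y] by (simp add: cross_wt_insert_left card_Diff_subset)
  qed
  also have "(\<Sum>Y\<in>?S (Suc i). cross_wt p q Y ({..<Suc n} - Y)) =
      (\<Sum>Y\<in>?S (Suc i). p ^ Suc i * cross_wt p q Y ({..<n} - Y))"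
  proof (intro sum.cong refl)
    fix Y assume Y: "Y \<in> ?S (Suc i)"
    then have "{..<Suc n} - Y = insert n ({..<n} - Y)"
      by (auto simp: less_Suc_eq)
    then show "cross_wt p q Y ({..<Suc n} - Y) = p ^ Suc i * cross_wt p q Y ({..<n} - Y)"
      using Y by (simp add: cross_wt_insert_right)
  qed
  finally show ?thesis
    by (simp add: pq_binom_def sum_distrib_left)
qed

lemma pq_binom_fact:
  "i \<le> n \<Longrightarrow> pq_binom p q n i * pq_fact p q i * pq_fact p q (n - i) = pq_fact p q n"
proof (induction n arbitrary: i)
  case (Suc n)
  show ?case
  proof (cases i)
    case i: (Suc j)
    then have "j \<le> n" using Suc.prems by simp
    note IH1 = Suc.IH[OF this]
    show ?thesis
    \<comment> \<open>For \<open>j = n\<close> the second term of the Pascal recurrence is zero, and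
      there is no induction hypothesis for \<open>Suc j\<close>.\<close>
    proof (cases "j = n")
      case True
      then have "pq_binom p q (Suc n) i * pq_fact p q i * pq_fact p q (Suc n - i) =
          pq_num p q (Suc n) * (pq_binom p q n j * pq_fact p q j * pq_fact p q (n - j))"
        by (simp add: i pq_binom_Suc_Suc pq_binom_eq_0 pq_fact_Suc mult.left_commute)
      then show ?thesis
        by (simp only: IH1 pq_fact_Suc)
    next
      case False
      then have "Suc j \<le> n" using \<open>j \<le> n\<close> by simp
      note IH2 = Suc.IH[OF this]
      obtain d where n: "n = Suc (j + d)"
        using \<open>Suc j \<le> n\<close> by (metis add_Suc le_Suc_ex)
      then have d: "Suc n - Suc j = Suc d" "n - j = Suc d" "n - Suc j = d"
        by simp_all
      have "pq_binom p q (Suc n) i * pq_fact p q i * pq_fact p q (Suc n - i) =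
         q ^ Suc d * pq_num p q (Suc j) * (pq_binom p q n j * pq_fact p q j * pq_fact p q (n - j)) +
         p ^ Suc j * pq_num p q (Suc d) *
           (pq_binom p q n (Suc j) * pq_fact p q (Suc j) * pq_fact p q (n - Suc j))"
        unfolding i d pq_binom_Suc_Suc pq_fact_Suc by (simp only: ring_distribs mult_ac)
      also have "\<dots> = (q ^ Suc d * pq_num p q (Suc j) + p ^ Suc j * pq_num p q (Suc d)) * pq_fact p q n"
        by (simp only: IH1 IH2 ring_distribs)
      also have "\<dots> = pq_fact p q (Suc n)"
        by (simp add: pq_num_add[symmetric] pq_fact_Suc n del: power_Suc)
      finally show ?thesis .
    qed
  qed simp
qed simp

section \<open>Generating functions of colored words\<close>

fun word_wt :: "'a::comm_ring_1 \<Rightarrow> 'a \<Rightarrow> 'a \<Rightarrow> (nat \<times> nat) list \<Rightarrow> 'a" where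
  "word_wt p q r [] = 1"
| "word_wt p q r (x # l) =
     r ^ snd x * (\<Prod>y\<leftarrow>l. pair_wt p q (fst x) (fst y)) * word_wt p q r l"

lemma word_wt_append:
  "word_wt p q r (u @ v) =
     word_wt p q r u * word_wt p q r v * (\<Prod>x\<leftarrow>u. \<Prod>y\<leftarrow>v. pair_wt p q (fst x) (fst y))"
  by (induction u) (simp_all add: algebra_simps)

text \<open>Arbitrary value sets are allowed so that the two factors of such a word are again of
  this kind.\<close>

definition colored_perms :: "nat \<Rightarrow> nat set \<Rightarrow> (nat \<times> nat) list set" where
  "colored_perms k X =
     {l. distinct (map fst l) \<and> fst ` set l = X \<and> snd ` set l \<subseteq> {..<k}}"

text \<open>Pairs with one letter in each factor are compared by value only, so their total weight
  depends on the two value sets and not on the arrangements.\<close>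

lemma word_wt_append_colored_perms:
  assumes "u \<in> colored_perms k Y" "v \<in> colored_perms k Z"
  shows "word_wt p q r (u @ v) = cross_wt p q Y Z * word_wt p q r u * word_wt p q r v"
proof -
  have *: "(\<Prod>x\<leftarrow>u. g (fst x)) = (\<Prod>x\<in>Y. g x)" if "u \<in> colored_perms k Y"
    for u Y and g :: "nat \<Rightarrow> 'a"
    using that prod.distinct_set_conv_list[of "map fst u" g]
    by (simp add: colored_perms_def o_def)
  show ?thesis
    using *[OF assms(1), of "\<lambda>y. \<Prod>z\<in>Z. pair_wt p q y z"]
    by (simp add: word_wt_append cross_wt_def *[OF assms(2)] algebra_simps)
qed

lemma length_colored_perms: "l \<in> colored_perms k X \<Longrightarrow> length l = card X"
  by (auto simp: colored_perms_def dest: distinct_card)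

lemma finite_colored_perms: "finite X \<Longrightarrow> finite (colored_perms k X)"
proof (rule finite_subset)
  show "colored_perms k X \<subseteq> {l. set l \<subseteq> X \<times> {..<k} \<and> length l = card X}"
    by (auto simp: length_colored_perms) (force simp: colored_perms_def)+
  show "finite X \<Longrightarrow> finite {l. set l \<subseteq> X \<times> {..<k} \<and> length l = card X}"
    by (intro finite_lists_length_eq) simp
qed

lemma map_apfst_colored_perms:
  assumes "bij_betw h A X" "l \<in> colored_perms k A"
  shows "map (apfst h) l \<in> colored_perms k X"
proof -
  have "map fst (map (apfst h) l) = map h (map fst l)"
    by simp
  moreover have "distinct (map h (map fst l))"
    using assms by (subst distinct_map) (auto simp: colored_perms_def bij_betw_def)
  moreover have "fst ` set (map (apfst h) l) = h ` fst ` set l"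
    by (auto simp: image_image)
  moreover have "snd ` set (map (apfst h) l) = snd ` set l"
    by (auto simp: image_image)
  ultimately show ?thesis
    using assms unfolding colored_perms_def bij_betw_def mem_Collect_eq by metis
qed

lemma word_wt_map_apfst:
  "strict_mono_on (fst ` set l) f \<Longrightarrow> word_wt p q r (map (apfst f) l) = word_wt p q r l"
proof (induction l)
  case (Cons x l)
  have "pair_wt p q (f (fst x)) (f (fst y)) = pair_wt p q (fst x) (fst y)" if "y \<in> set l" for y
    using that strict_mono_on_less[OF Cons.prems, of "fst y" "fst x"] by (simp add: pair_wt_def)
  then have "map (\<lambda>y. pair_wt p q (f (fst x)) (f (fst y))) l = map (\<lambda>y. pair_wt p q (fst x) (fst y)) l"
    by simp
  moreover have "strict_mono_on (fst ` set l) f"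
    using Cons.prems by (rule monotone_on_subset) auto
  ultimately show ?case
    using Cons.IH by (simp add: o_def del: map_eq_conv)
qed simp

section \<open>Multiplicativity of the word series\<close>

definition perm_sum :: "'a::comm_ring_1 \<Rightarrow> 'a \<Rightarrow> 'a \<Rightarrow> nat \<Rightarrow> ((nat \<times> nat) list \<Rightarrow> 'a) \<Rightarrow>
    nat set \<Rightarrow> 'a" where
  "perm_sum p q r k \<Phi> X = (\<Sum>l\<in>colored_perms k X. word_wt p q r l * \<Phi> l)"

lemma perm_sum_order_iso:
  assumes h: "bij_betw h A X" "strict_mono_on A h" and inv: "order_invariant \<Phi>"
  shows "perm_sum p q r k \<Phi> X = perm_sum p q r k \<Phi> A"
  unfolding perm_sum_def
proof (rule sum.reindex_bij_witness[of _ "map (apfst h)" "map (apfst (inv_into A h))"])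
  note surj = bij_betw_imp_surj_on[OF h(1)]
  note h' = bij_betw_inv_into[OF h(1)]
  fix l assume l: "l \<in> colored_perms k X"
  have "h (inv_into A h (fst x)) = fst x" if "x \<in> set l" for x
    using l that by (auto simp: colored_perms_def f_inv_into_f surj)
  then show id: "map (apfst h) (map (apfst (inv_into A h)) l) = l"
    by (simp add: map_idI prod_eq_iff)
  show mem: "map (apfst (inv_into A h)) l \<in> colored_perms k A"
    by (rule map_apfst_colored_perms[OF h' l])
  let ?l = "map (apfst (inv_into A h)) l"
  have "strict_mono_on (fst ` set ?l) h"
    using h(2) mem by (simp only: colored_perms_def mem_Collect_eq)
  then have "word_wt p q r (map (apfst h) ?l) = word_wt p q r ?l" "\<Phi> (map (apfst h) ?l) = \<Phi> ?l"
    using inv by (simp_all only: word_wt_map_apfst order_invariant_def)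
  then show "word_wt p q r ?l * \<Phi> ?l = word_wt p q r l * \<Phi> l"
    by (simp only: id)
next
  fix l assume l: "l \<in> colored_perms k A"
  show "map (apfst h) l \<in> colored_perms k X"
    by (rule map_apfst_colored_perms[OF h(1) l])
  have "inv_into A h (h (fst x)) = fst x" if "x \<in> set l" for x
    using l that
    by (intro inv_into_f_f[OF bij_betw_imp_inj_on[OF h(1)]]) (auto simp: colored_perms_def)
  then show "map (apfst (inv_into A h)) (map (apfst h) l) = l"
    by (simp add: map_idI prod_eq_iff)
qed

lemma perm_sum_card:
  assumes "finite X" "order_invariant \<Phi>"
  shows "perm_sum p q r k \<Phi> X = perm_sum p q r k \<Phi> {..<card X}"
proof -
  obtain h where "bij_betw h {..<card X} X" "strict_mono_on {..<card X} h"
    using ex_bij_betw_strict_mono_card[OF assms(1)] .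
  then show ?thesis by (rule perm_sum_order_iso) fact
qed

text \<open>A word with a chosen cut is the same as a value set \<open>Y\<close> for the prefix
  together with arrangements of \<open>Y\<close> and of its complement.\<close>

lemma perm_sum_conv:
  assumes X: "finite X"
  shows "perm_sum p q r k (conv \<Phi> \<Psi>) X =
    (\<Sum>Y\<in>Pow X. cross_wt p q Y (X - Y) * perm_sum p q r k \<Phi> Y * perm_sum p q r k \<Psi> (X - Y))"
proof -
  let ?C = "colored_perms k"
  let ?S = "Sigma (Pow X) (\<lambda>Y. ?C Y \<times> ?C (X - Y))"
  have fin: "finite (?C Y)" if "Y \<subseteq> X" for Y
    using that X by (intro finite_colored_perms) (rule finite_subset)
  have "perm_sum p q r k (conv \<Phi> \<Psi>) X =
      (\<Sum>l\<in>?C X. \<Sum>i\<le>length l. word_wt p q r l * (\<Phi> (take i l) * \<Psi> (drop i l)))"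
    by (simp add: perm_sum_def conv_def sum_distrib_left)
  also have "\<dots> = (\<Sum>(l, i)\<in>Sigma (?C X) (\<lambda>l. {..length l}).
      word_wt p q r l * (\<Phi> (take i l) * \<Psi> (drop i l)))"
    by (rule sum.Sigma) (auto simp: fin)
  also have "\<dots> = (\<Sum>(Y, u, v)\<in>?S.
      cross_wt p q Y (X - Y) * (word_wt p q r u * \<Phi> u) * (word_wt p q r v * \<Psi> v))"
  proof (rule sum.reindex_bij_witness[where
        i = "\<lambda>(Y, u, v). (u @ v, length u)" and
        j = "\<lambda>(l, i). (fst ` set (take i l), take i l, drop i l)"])
    fix a assume "a \<in> Sigma (?C X) (\<lambda>l. {..length l})"
    then obtain l i where a: "a = (l, i)" and l: "l \<in> ?C X" and i: "i \<le> length l" by auto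
    have l': "distinct (map fst (take i l @ drop i l))" "fst ` set (take i l @ drop i l) = X"
      "snd ` set (take i l @ drop i l) \<subseteq> {..<k}"
      using l by (simp_all add: colored_perms_def)
    let ?Y = "fst ` set (take i l)"
    have "fst ` set (drop i l) = X - ?Y"
      using l'(1,2) unfolding map_append distinct_append set_append image_Un set_map by blast
    then have uv: "take i l \<in> ?C ?Y" "drop i l \<in> ?C (X - ?Y)" "?Y \<subseteq> X"
      using l' by (auto simp: colored_perms_def simp del: append_take_drop_id)
    show "(case (case a of (l, i) \<Rightarrow> (fst ` set (take i l), take i l, drop i l)) of
        (Y, u, v) \<Rightarrow> (u @ v, length u)) = a"
      using i by (simp add: a)
    show "(case a of (l, i) \<Rightarrow> (fst ` set (take i l), take i l, drop i l)) \<in> ?S"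
      using uv by (simp add: a)
    show "(case (case a of (l, i) \<Rightarrow> (fst ` set (take i l), take i l, drop i l)) of
        (Y, u, v) \<Rightarrow> cross_wt p q Y (X - Y) * (word_wt p q r u * \<Phi> u) * (word_wt p q r v * \<Psi> v)) =
      (case a of (l, i) \<Rightarrow> word_wt p q r l * (\<Phi> (take i l) * \<Psi> (drop i l)))"
      using word_wt_append_colored_perms[OF uv(1,2), of p q r] by (simp add: a)
  next
    fix b assume "b \<in> ?S"
    then obtain Y u v where b: "b = (Y, u, v)" and Y: "Y \<subseteq> X" and u: "u \<in> ?C Y"
      and v: "v \<in> ?C (X - Y)" by auto
    show "(case (case b of (Y, u, v) \<Rightarrow> (u @ v, length u)) of
        (l, i) \<Rightarrow> (fst ` set (take i l), take i l, drop i l)) = b"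
      using u by (simp add: b colored_perms_def)
    have "u @ v \<in> ?C X"
      using u v Y by (auto simp: colored_perms_def)
    then show "(case b of (Y, u, v) \<Rightarrow> (u @ v, length u)) \<in> Sigma (?C X) (\<lambda>l. {..length l})"
      by (simp add: b)
  qed
  also have "\<dots> = (\<Sum>Y\<in>Pow X. \<Sum>(u, v)\<in>?C Y \<times> ?C (X - Y).
      cross_wt p q Y (X - Y) * (word_wt p q r u * \<Phi> u) * (word_wt p q r v * \<Psi> v))"
    using X by (subst sum.Sigma) (auto simp: fin)
  also have "\<dots> = (\<Sum>Y\<in>Pow X. cross_wt p q Y (X - Y) * perm_sum p q r k \<Phi> Y * perm_sum p q r k \<Psi> (X - Y))"
    unfolding sum.cartesian_product[symmetric] perm_sum_def mult.assoc
    by (simp only: sum_product) (simp only: sum_distrib_left mult.assoc)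
  finally show ?thesis .
qed

definition word_gf :: "'a::field \<Rightarrow> 'a \<Rightarrow> 'a \<Rightarrow> nat \<Rightarrow> ((nat \<times> nat) list \<Rightarrow> 'a) \<Rightarrow> 'a fps" where
  "word_gf p q r k \<Phi> = Abs_fps (\<lambda>n. perm_sum p q r k \<Phi> {..<n} / pq_fact p q n)"

text \<open>By order invariance the summand for \<open>Y\<close> depends on \<open>Y\<close> only
  through its size and its cross weight. Grouping by size produces \<open>pq_binom\<close>, whose
  factorial formula turns the sum into a Cauchy product.\<close>

lemma word_gf_conv:
  fixes p q r :: "'a::field"
  assumes nz: "\<And>n. n \<ge> 1 \<Longrightarrow> pq_num p q n \<noteq> 0"
    and inv: "order_invariant \<Phi>" "order_invariant \<Psi>"
  shows "word_gf p q r k (conv \<Phi> \<Psi>) = word_gf p q r k \<Phi> * word_gf p q r k \<Psi>"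
proof (rule fps_ext)
  fix n
  let ?S = "\<lambda>\<Phi> n. perm_sum p q r k \<Phi> {..<n}"
  have nzf: "pq_fact p q m \<noteq> 0" for m
    using nz by (simp add: pq_fact_def)
  have "?S (conv \<Phi> \<Psi>) n =
      (\<Sum>Y\<in>Pow {..<n}. cross_wt p q Y ({..<n} - Y) * ?S \<Phi> (card Y) * ?S \<Psi> (n - card Y))"
    unfolding perm_sum_conv[OF finite_lessThan]
  proof (intro sum.cong refl)
    fix Y assume "Y \<in> Pow {..<n}"
    then have Y: "Y \<subseteq> {..<n}" "finite Y" using finite_subset by auto
    then have "card ({..<n} - Y) = n - card Y" by (simp add: card_Diff_subset)
    then show "cross_wt p q Y ({..<n} - Y) * perm_sum p q r k \<Phi> Y * perm_sum p q r k \<Psi> ({..<n} - Y)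
      = cross_wt p q Y ({..<n} - Y) * ?S \<Phi> (card Y) * ?S \<Psi> (n - card Y)"
      using perm_sum_card[OF Y(2) inv(1), of p q r k]
        perm_sum_card[of "{..<n} - Y", OF _ inv(2), of p q r k] by simp
  qed
  also have "\<dots> = (\<Sum>i\<le>n. \<Sum>Y | Y \<in> Pow {..<n} \<and> card Y = i.
      cross_wt p q Y ({..<n} - Y) * ?S \<Phi> (card Y) * ?S \<Psi> (n - card Y))"
    by (rule sum.group[symmetric]) (auto dest: card_mono[OF finite_lessThan])
  also have "\<dots> = (\<Sum>i\<le>n. pq_binom p q n i * (?S \<Phi> i * ?S \<Psi> (n - i)))"
    by (intro sum.cong refl) (simp add: pq_binom_def sum_distrib_right mult.assoc)
  finally have "?S (conv \<Phi> \<Psi>) n / pq_fact p q n =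
      (\<Sum>i\<le>n. pq_binom p q n i * (?S \<Phi> i * ?S \<Psi> (n - i)) / pq_fact p q n)"
    by (simp add: sum_divide_distrib)
  also have "\<dots> = (\<Sum>i\<le>n. (?S \<Phi> i / pq_fact p q i) * (?S \<Psi> (n - i) / pq_fact p q (n - i)))"
  proof (intro sum.cong refl)
    fix i assume "i \<in> {..n}"
    then have "pq_binom p q n i * pq_fact p q i * pq_fact p q (n - i) = pq_fact p q n"
      by (simp add: pq_binom_fact)
    then have "pq_binom p q n i = pq_fact p q n / (pq_fact p q i * pq_fact p q (n - i))"
      using nzf by (simp add: field_simps)
    then show "pq_binom p q n i * (?S \<Phi> i * ?S \<Psi> (n - i)) / pq_fact p q n =
        (?S \<Phi> i / pq_fact p q i) * (?S \<Psi> (n - i) / pq_fact p q (n - i))"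
      using nzf by simp
  qed
  finally show "word_gf p q r k (conv \<Phi> \<Psi>) $ n = (word_gf p q r k \<Phi> * word_gf p q r k \<Psi>) $ n"
    by (simp add: word_gf_def fps_mult_nth atLeast0AtMost)
qed

section \<open>Series of run weights\<close>

lemma word_wt_map_upt:
  "word_wt p q r (map f [m..<n]) =
     (\<Prod>i\<in>{m..<n}. r ^ snd (f i)) *
     (\<Prod>i\<in>{m..<n}. \<Prod>j\<in>{Suc i..<n}. pair_wt p q (fst (f i)) (fst (f j)))"
\<comment> \<open>Splitting off the first letter raises \<open>m\<close>, so the induction is on the
  length of the list.\<close>
proof (induction "n - m" arbitrary: m)
  case (Suc d)
  then have "m < n" by simp
  have "(\<Prod>j\<leftarrow>[Suc m..<n]. pair_wt p q (fst (f m)) (fst (f j))) =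
      (\<Prod>j\<in>{Suc m..<n}. pair_wt p q (fst (f m)) (fst (f j)))"
    by (simp add: prod.distinct_set_conv_list[symmetric])
  with \<open>m < n\<close> Suc.hyps(1)[of "Suc m"] Suc.hyps(2) show ?case
    by (simp add: upt_rec[of m n] prod.atLeast_Suc_lessThan[of m n] o_def mult_ac)
qed simp

text \<open>Increasing values filling \<open>{..<n}\<close> are forced, and only the common color is
  free. The empty word carries no color and counts once, not \<open>k\<close> times, which gives
  \<open>P_ser\<close> its constant term 1.\<close>

lemma run_in_colored_perms_iff:
  "l \<in> colored_perms k {..<n} \<and> sorted_wrt rise l \<longleftrightarrow>
     (if n = 0 then l = [] else \<exists>c<k. l = map (\<lambda>i. (i, c)) [0..<n])"
proof (cases "n = 0")
  case True
  then show ?thesis by (auto simp: colored_perms_def)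
next
  case False
  have "\<exists>c<k. l = map (\<lambda>i. (i, c)) [0..<n]"
    if l: "l \<in> colored_perms k {..<n}" and run: "sorted_wrt rise l"
  proof -
    have "sorted_wrt (<) (map fst l)"
      using run unfolding sorted_wrt_map by (rule sorted_wrt_mono_rel[rotated]) (simp add: rise_def)
    moreover have "set (map fst l) = set [0..<n]"
      using l by (auto simp: colored_perms_def)
    ultimately have fst: "map fst l = [0..<n]"
      by (metis sorted_wrt_upt strict_sorted_equal)
    then have len: "length l = n"
      by (metis length_map length_upt diff_zero)
    define c where "c = snd (l ! 0)"
    have "snd (l ! i) = c" if "i < n" for i
      using that sorted_wrt_nth_less[OF run, of 0 i] len unfolding c_def rise_def
      by (cases "i = 0") auto
    moreover have "fst (l ! i) = i" if "i < n" for i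
      using that fst len by (metis nth_map nth_upt add_0)
    ultimately have "l = map (\<lambda>i. (i, c)) [0..<n]"
      using len by (intro nth_equalityI) (auto simp: prod_eq_iff)
    moreover have "c < k"
      using l len False nth_mem[of 0 l] unfolding colored_perms_def c_def by blast
    ultimately show ?thesis by blast
  qed
  moreover have "map (\<lambda>i. (i, c)) [0..<n] \<in> colored_perms k {..<n}"
    "sorted_wrt rise (map (\<lambda>i. (i, c)) [0..<n])" if "c < k" for c
    using that by (auto simp: colored_perms_def o_def sorted_wrt_map rise_def image_image)
  ultimately show ?thesis using False by auto
qed

text \<open>All \<open>n choose 2\<close> pairs of a run are coinversions, and color
  \<open>j\<close> contributes \<open>(r ^ n) ^ j\<close>; summing over \<open>j\<close> gives the
  factor \<open>r_num k (r ^ n)\<close>.\<close>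

lemma perm_sum_run_wt:
  "perm_sum p q r k (run_wt c) {..<n} =
     (if n = 0 then c 0 else c n * p ^ (n choose 2) * r_num k (r ^ n))"
proof -
  let ?l = "\<lambda>c. map (\<lambda>i. (i, c)) [0..<n]"
  have wt: "word_wt p q r (?l j) = p ^ (n choose 2) * (r ^ n) ^ j" for j
  proof -
    have "(\<Prod>i\<in>{0..<n}. \<Prod>j\<in>{Suc i..<n}. pair_wt p q i j) = (\<Prod>i<n. p ^ (n - Suc i))"
      by (auto simp: pair_wt_def atLeast0LessThan intro!: prod.cong)
    also have "\<dots> = p ^ (\<Sum>i<n. n - Suc i)"
      by (simp add: power_sum)
    also have "(\<Sum>i<n. n - Suc i) = (n choose 2)"
      unfolding sum.nat_diff_reindex[of "\<lambda>i. i"]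
      by (induction n) (simp_all add: numeral_2_eq_2)
    finally show ?thesis
      by (simp add: word_wt_map_upt power_mult[symmetric] mult.commute)
  qed
  have "perm_sum p q r k (run_wt c) {..<n} =
      (\<Sum>l | l \<in> colored_perms k {..<n} \<and> sorted_wrt rise l. word_wt p q r l * run_wt c l)"
    unfolding perm_sum_def
    by (rule sum.mono_neutral_right) (auto simp: finite_colored_perms run_wt_def)
  also have "\<dots> = (if n = 0 then c 0 else (\<Sum>j<k. word_wt p q r (?l j) * c n))"
  proof (cases "n = 0")
    case False
    have inj: "inj_on ?l {..<k}"
    proof (rule inj_onI)
      fix x y assume "?l x = ?l y"
      then have "?l x ! 0 = ?l y ! 0" by (rule arg_cong)
      then show "x = y" using False by simp
    qed
    have "{l. l \<in> colored_perms k {..<n} \<and> sorted_wrt rise l} = ?l ` {..<k}"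
      using False by (auto simp: run_in_colored_perms_iff)
    moreover have "run_wt c (?l j) = c n" for j
      by (simp add: run_wt_def sorted_wrt_map rise_def)
    ultimately show ?thesis
      using False inj by (simp add: sum.reindex)
  next
    case True
    then have "{l. l \<in> colored_perms k {..<n} \<and> sorted_wrt rise l} = {[]}"
      unfolding run_in_colored_perms_iff by simp
    with True show ?thesis by (simp add: run_wt_def)
  qed
  finally show ?thesis
    by (simp add: wt r_num_def sum_distrib_left sum_distrib_right mult_ac)
qed

section \<open>Colored permutations as words\<close>

definition word_of :: "nat \<Rightarrow> (nat \<Rightarrow> nat) \<Rightarrow> (nat \<Rightarrow> nat) \<Rightarrow> (nat \<times> nat) list" where
  "word_of n \<sigma> w = map (\<lambda>i. (\<sigma> i, w i)) [1..<Suc n]"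

lemma length_word_of [simp]: "length (word_of n \<sigma> w) = n"
  by (simp add: word_of_def)

lemma nth_word_of: "i < n \<Longrightarrow> word_of n \<sigma> w ! i = (\<sigma> (Suc i), w (Suc i))"
  by (simp add: word_of_def del: upt_Suc)

lemma WRis_eq: "WRis n \<sigma> w = Suc ` rises (word_of n \<sigma> w)"
proof -
  have "i \<in> WRis n \<sigma> w \<longleftrightarrow> i \<in> Suc ` rises (word_of n \<sigma> w)" for i
    by (cases i) (auto simp: WRis_def rises_def rise_def nth_word_of)
  then show ?thesis by blast
qed

lemma word_wt_word_of:
  assumes "\<sigma> permutes {1..n}"
  shows "word_wt p q r (word_of n \<sigma> w) =
    q ^ inv_stat n \<sigma> * p ^ coinv_stat n \<sigma> * r ^ word_norm n w"
proof -
  let ?P = "Sigma {1..<Suc n} (\<lambda>i. {Suc i..<Suc n})"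
  have inv: "?P \<inter> {ab. \<sigma> (snd ab) < \<sigma> (fst ab)} =
      {(a, b). a \<in> {1..n} \<and> b \<in> {1..n} \<and> a < b \<and> \<sigma> a > \<sigma> b}"
    by auto
  \<comment> \<open>Injectivity makes every pair that is not an inversion a coinversion.\<close>
  have neq: "\<sigma> a \<noteq> \<sigma> b" if "a < b" for a b
    using permutes_inj[OF assms] that by (auto dest: injD)
  have less: "\<not> \<sigma> b < \<sigma> a \<longleftrightarrow> \<sigma> a < \<sigma> b" if "a < b" for a b
    using neq[OF that] by auto
  have coinv: "?P \<inter> - {ab. \<sigma> (snd ab) < \<sigma> (fst ab)} =
      {(a, b). a \<in> {1..n} \<and> b \<in> {1..n} \<and> a < b \<and> \<sigma> a < \<sigma> b}"
    by (auto simp: less)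
  have "(\<Prod>i\<in>{1..<Suc n}. \<Prod>j\<in>{Suc i..<Suc n}. pair_wt p q (\<sigma> i) (\<sigma> j)) =
      (\<Prod>ab\<in>?P. if \<sigma> (snd ab) < \<sigma> (fst ab) then q else p)"
    by (subst prod.Sigma) (auto simp: pair_wt_def split_beta)
  also have "\<dots> = q ^ inv_stat n \<sigma> * p ^ coinv_stat n \<sigma>"
  proof -
    have "finite ?P" by simp
    then show ?thesis
      by (simp only: prod.If_cases inv coinv inv_stat_def coinv_stat_def prod_constant)
  qed
  finally have pairs: "(\<Prod>i\<in>{1..<Suc n}. \<Prod>j\<in>{Suc i..<Suc n}. pair_wt p q (\<sigma> i) (\<sigma> j)) =
      q ^ inv_stat n \<sigma> * p ^ coinv_stat n \<sigma>" .
  have norm: "(\<Prod>i\<in>{1..<Suc n}. r ^ w i) = r ^ word_norm n w"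
    by (simp only: word_norm_def power_sum atLeastLessThanSuc_atLeastAtMost)
  show ?thesis
    unfolding word_of_def word_wt_map_upt fst_conv snd_conv norm pairs by (rule mult.commute)
qed

lemma bij_betw_word_of:
  "bij_betw (\<lambda>(\<sigma>, w). word_of n \<sigma> w) (wreath n k) (colored_perms k {1..n})"
proof -
  \<comment> \<open>Outside \<open>{1..n}\<close> the decoding takes the values that
    \<open>permutes\<close> and the extensional function space prescribe: the identity and
    \<open>undefined\<close>.\<close>
  define dec where "dec l = (\<lambda>i. if i \<in> {1..n} then fst (l ! (i - 1)) else i,
      \<lambda>i\<in>{1..n}. snd (l ! (i - 1)))" for l :: "(nat \<times> nat) list"
  show ?thesis
  proof (rule bij_betw_byWitness[where f' = dec])
    have "dec (word_of n \<sigma> w) = (\<sigma>, w)" if "(\<sigma>, w) \<in> wreath n k" for \<sigma> w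
    proof -
      from that have \<sigma>: "\<sigma> permutes {1..n}" and w: "w \<in> {1..n} \<rightarrow>\<^sub>E {0..<k}"
        by (auto simp: wreath_def)
      have "fst (dec (word_of n \<sigma> w)) i = \<sigma> i" "snd (dec (word_of n \<sigma> w)) i = w i" for i
        using permutes_not_in[OF \<sigma>, of i] PiE_arb[OF w, of i]
        by (auto simp: dec_def nth_word_of)
      then show ?thesis by (simp add: prod_eq_iff fun_eq_iff)
    qed
    then show "\<forall>a\<in>wreath n k. dec (case a of (\<sigma>, w) \<Rightarrow> word_of n \<sigma> w) = a"
      by auto
    show "\<forall>l\<in>colored_perms k {1..n}. (case dec l of (\<sigma>, w) \<Rightarrow> word_of n \<sigma> w) = l"
      by (auto dest!: length_colored_perms intro!: nth_equalityI simp: nth_word_of dec_def)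
    show "(\<lambda>(\<sigma>, w). word_of n \<sigma> w) ` wreath n k \<subseteq> colored_perms k {1..n}"
    proof clarify
      fix \<sigma> w assume "(\<sigma>, w) \<in> wreath n k"
      then have \<sigma>: "\<sigma> permutes {1..n}" and w: "w \<in> {1..n} \<rightarrow>\<^sub>E {0..<k}"
        by (auto simp: wreath_def)
      have "distinct (map \<sigma> [1..<Suc n])"
        using permutes_inj_on[OF \<sigma>] by (simp add: distinct_map del: upt_Suc)
      moreover have "w ` {1..n} \<subseteq> {..<k}"
        using w by (auto dest: PiE_mem)
      ultimately show "word_of n \<sigma> w \<in> colored_perms k {1..n}"
        using permutes_image[OF \<sigma>]
        by (simp add: colored_perms_def word_of_def image_image o_def
            atLeastLessThanSuc_atLeastAtMost del: upt_Suc)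
    qed
    show "dec ` colored_perms k {1..n} \<subseteq> wreath n k"
    proof (rule image_subsetI)
      fix l assume l: "l \<in> colored_perms k {1..n}"
      then have len: "length l = n" by (auto dest: length_colored_perms)
      let ?\<sigma> = "\<lambda>i. if i \<in> {1..n} then fst (l ! (i - 1)) else i"
      have "?\<sigma> ` {1..n} = (\<lambda>i. fst (l ! i)) ` {..<n}"
      proof -
        have "{1..n} = Suc ` {..<n}"
          by (simp add: lessThan_atLeast0 image_Suc_atLeastLessThan atLeastLessThanSuc_atLeastAtMost)
        then show ?thesis by (simp only: image_image) (auto intro!: image_cong)
      qed
      also have "\<dots> = fst ` set l"
        by (auto simp: set_conv_nth len)
      also have "\<dots> = {1..n}"
        using l by (simp add: colored_perms_def)
      finally have "?\<sigma> ` {1..n} = {1..n}" .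
      \<comment> \<open>A map of a finite set onto itself is injective.\<close>
      then have "?\<sigma> permutes {1..n}"
        by (intro bij_imp_permutes) (auto simp: bij_betw_def eq_card_imp_inj_on simp del: if_split)
      moreover have "snd (l ! (i - 1)) < k" if "i \<in> {1..n}" for i
      proof -
        have "l ! (i - 1) \<in> set l" using that len by (intro nth_mem) auto
        then show ?thesis using l unfolding colored_perms_def by blast
      qed
      ultimately show "dec l \<in> wreath n k"
        by (auto simp: wreath_def dec_def)
    qed
  qed
qed

lemma gen_fun_eq_word_gf:
  fixes p q r :: "'a::field"
  assumes "\<And>n. A n = {(\<sigma>, w) \<in> wreath n k. Q (rises (word_of n \<sigma> w))}"
  shows "gen_fun p q r A = word_gf p q r k (\<lambda>l. of_bool (Q (rises l)))"
proof (rule fps_ext)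
  fix n
  let ?f = "\<lambda>l. word_wt p q r l * of_bool (Q (rises l))"
  have fin: "finite (wreath n k)"
    by (auto simp: wreath_def finite_permutations intro!: finite_PiE)
  have "(\<Sum>(\<sigma>, w)\<in>A n. q ^ inv_stat n \<sigma> * p ^ coinv_stat n \<sigma> * r ^ word_norm n w) =
      (\<Sum>(\<sigma>, w)\<in>A n. ?f (word_of n \<sigma> w))"
    by (rule sum.cong) (auto simp: assms wreath_def word_wt_word_of)
  also have "\<dots> = (\<Sum>(\<sigma>, w)\<in>wreath n k. ?f (word_of n \<sigma> w))"
    by (rule sum.mono_neutral_left) (auto simp: assms fin)
  also have "\<dots> = (\<Sum>a\<in>wreath n k. ?f (case a of (\<sigma>, w) \<Rightarrow> word_of n \<sigma> w))"
    by (rule sum.cong) auto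
  also have "\<dots> = perm_sum p q r k (\<lambda>l. of_bool (Q (rises l))) {1..n}"
    unfolding perm_sum_def by (rule sum.reindex_bij_betw[OF bij_betw_word_of])
  \<comment> \<open>Order invariance allows the shift of the values from \<open>{1..n}\<close> to
    \<open>{..<n}\<close>.\<close>
  also have "\<dots> = perm_sum p q r k (\<lambda>l. of_bool (Q (rises l))) {..<n}"
    by (subst perm_sum_card) (auto intro: order_invariant_rises)
  finally show "gen_fun p q r A $ n = word_gf p q r k (\<lambda>l. of_bool (Q (rises l))) $ n"
    by (simp add: gen_fun_def word_gf_def)
qed

text \<open>The bounds on \<open>s\<close> follow from the range of positions in
  \<open>WRis\<close>; passing to list positions lowers every index by one.\<close>

lemma U_set_eq:
  "U_set n k = {(\<sigma>, w) \<in> wreath n k. \<exists>s. rises (word_of n \<sigma> w) = {s, Suc s}}"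
proof -
  have "(\<exists>s. 1 \<le> s \<and> s + 2 \<le> n \<and> WRis n \<sigma> w = {s, s + 1}) \<longleftrightarrow>
      (\<exists>s. rises (word_of n \<sigma> w) = {s, Suc s})" for \<sigma> w
  proof -
    have "s + 2 \<le> n" if "WRis n \<sigma> w = {s, Suc s}" for s
    proof -
      have "Suc s \<in> WRis n \<sigma> w" using that by simp
      then show ?thesis by (simp add: WRis_def)
    qed
    then have "(\<exists>s. 1 \<le> s \<and> s + 2 \<le> n \<and> WRis n \<sigma> w = {s, s + 1}) \<longleftrightarrow>
        (\<exists>s\<ge>1. WRis n \<sigma> w = {s, Suc s})"
      by auto
    then show ?thesis by (simp only: WRis_eq image_Suc_eq_pair) auto
  qed
  then show ?thesis by (simp add: U_set_def)
qed

lemma V_set_eq: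
  "V_set n k = {(\<sigma>, w) \<in> wreath n k. card (rises (word_of n \<sigma> w)) = 2 \<and>
     \<not> (\<exists>s. rises (word_of n \<sigma> w) = {s, Suc s})}"
proof -
  have *: "(\<exists>i j. i + 2 \<le> j \<and> Suc ` A = {i, j}) \<longleftrightarrow> card A = 2 \<and> \<not> (\<exists>s. A = {s, Suc s})" for A
  proof
    assume "\<exists>i j. i + 2 \<le> j \<and> Suc ` A = {i, j}"
    then obtain i j where ij: "i + 2 \<le> j" "Suc ` A = {i, j}" by blast
    then obtain i' j' where "i = Suc i'" "j = Suc j'"
      by (metis imageE insertI1 insertI2)
    with ij have "A = {i', j'}"
      by (metis image_empty image_insert inj_Suc inj_image_eq_iff)
    with ij \<open>i = Suc i'\<close> \<open>j = Suc j'\<close> show "card A = 2 \<and> \<not> (\<exists>s. A = {s, Suc s})"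
      by (auto simp: doubleton_eq_iff)
  next
    assume A: "card A = 2 \<and> \<not> (\<exists>s. A = {s, Suc s})"
    then obtain x y where xy: "A = {x, y}" "x \<noteq> y" by (auto simp: card_2_iff)
    define i j where "i = min x y" and "j = max x y"
    have ij: "A = {i, j}" "i < j" using xy by (auto simp: i_def j_def min_def max_def)
    with A have "j \<noteq> Suc i" by auto
    with ij have "Suc i + 2 \<le> Suc j" "Suc ` A = {Suc i, Suc j}" by auto
    then show "\<exists>i j. i + 2 \<le> j \<and> Suc ` A = {i, j}" by blast
  qed
  show ?thesis by (simp only: V_set_def WRis_eq *)
qed

section \<open>The generating functions\<close>

lemma word_gf_nth: "word_gf p q r k \<Phi> $ n = perm_sum p q r k \<Phi> {..<n} / pq_fact p q n"
  by (simp add: word_gf_def)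

lemma word_gf_add: "word_gf p q r k (\<lambda>l. \<Phi> l + \<Psi> l) = word_gf p q r k \<Phi> + word_gf p q r k \<Psi>"
  by (rule fps_ext) (simp add: word_gf_nth perm_sum_def sum.distrib distrib_left add_divide_distrib)

lemma word_gf_diff: "word_gf p q r k (\<lambda>l. \<Phi> l - \<Psi> l) = word_gf p q r k \<Phi> - word_gf p q r k \<Psi>"
  by (rule fps_ext)
    (simp add: word_gf_nth perm_sum_def sum_subtractf right_diff_distrib diff_divide_distrib)

lemma word_gf_run_wt_nth:
  "word_gf p q r k (run_wt c) $ n =
     (if n = 0 then c 0 else c n * (p ^ (n choose 2) * r_num k (r ^ n) / pq_fact p q n))"
  by (simp add: word_gf_nth perm_sum_run_wt)

lemma word_gf_altc: "word_gf p q r k (run_wt altc) = P_ser p q r k"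
  by (rule fps_ext) (auto simp: word_gf_run_wt_nth P_ser_def base_coeff_def altc_def)

lemma word_gf_gc: "word_gf p q r k (run_wt gc) = G_ser p q r k"
  by (rule fps_ext) (auto simp: word_gf_run_wt_nth G_ser_def base_coeff_def gc_def)

lemma word_gf_hc: "word_gf p q r k (run_wt hc) = H_ser p q r k"
  by (rule fps_ext) (simp add: word_gf_run_wt_nth H_ser_def base_coeff_def hc_def binomial_eq_0)

text \<open>From length 2 on, \<open>uc\<close> is \<open>altc - gc\<close>. The bracket removes the
  constant term of \<open>P_ser\<close> and cancels its linear term, which is minus
  \<open>r_num k r\<close>.\<close>

lemma word_gf_uc:
  "word_gf p q r k (run_wt uc) =
     (fps_const (r_num k r) * fps_X - 1) + P_ser p q r k - G_ser p q r k"
proof (rule fps_ext)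
  fix n
  consider "n = 0" | "n = 1" | m where "n = Suc (Suc m)"
    by (metis One_nat_def not0_implies_Suc)
  then show "word_gf p q r k (run_wt uc) $ n =
      ((fps_const (r_num k r) * fps_X - 1) + P_ser p q r k - G_ser p q r k) $ n"
  proof cases
    case 2
    then show ?thesis
      by (simp add: word_gf_run_wt_nth P_ser_def G_ser_def base_coeff_def pq_fact_def pq_num_def
          numeral_2_eq_2)
  next
    case 3
    then show ?thesis
      by (simp add: word_gf_run_wt_nth P_ser_def G_ser_def base_coeff_def uc_def
          fps_X_def distrib_right add_divide_distrib)
  qed (simp_all add: word_gf_run_wt_nth P_ser_def G_ser_def)
qed

theorem theorem16:
  fixes p q r :: "'a::field" and k :: nat
  assumes "k \<ge> 2"
    and "\<And>n. n \<ge> 1 \<Longrightarrow> pq_num p q n \<noteq> 0"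
  shows "gen_fun p q r (\<lambda>n. U_set n k) =
           ((fps_const (r_num k r) * fps_X - 1) + P_ser p q r k - G_ser p q r k)
             / (P_ser p q r k) ^ 2 \<and>
         gen_fun p q r (\<lambda>n. V_set n k) =
           ((G_ser p q r k) ^ 2 + P_ser p q r k *
             (H_ser p q r k + G_ser p q r k - (fps_const (r_num k r) * fps_X - 1) - P_ser p q r k))
             / (P_ser p q r k) ^ 3"
proof -
  let ?gf = "word_gf p q r k"
  define P where "P = P_ser p q r k"
  define G where "G = G_ser p q r k"
  define H where "H = H_ser p q r k"
  define K where "K = (fps_const (r_num k r) * fps_X - 1) + P - G"
  define N where "N = ?gf (rises_ind 0)"
  define R where "R = ?gf (rises_ind (Suc 0))"
  define T where "T = ?gf (rises_ind 2)"
  define U where "U = ?gf adj_ind"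
  have inv: "order_invariant (rises_ind j :: _ \<Rightarrow> 'a)" "order_invariant (adj_ind :: _ \<Rightarrow> 'a)" for j
    unfolding rises_ind_def[abs_def] adj_ind_def[abs_def] by (rule order_invariant_rises)+
  note mult = word_gf_conv[OF assms(2) order_invariant_run_wt, symmetric]
  \<comment> \<open>By \<open>mult\<close>, a product with the series of a run weight is the series
    of a convolution, so the word identities become identities of series.\<close>
  have "P * N = ?gf (\<lambda>l. if l = [] then 1 else 0)"
    by (simp add: P_def N_def word_gf_altc[symmetric] mult inv conv_altc_ind_0[abs_def])
  also have "(\<lambda>l. if l = [] then 1 else 0) = run_wt (\<lambda>n. if n = 0 then 1 else 0)"
    by (auto simp: run_wt_def)
  also have "?gf \<dots> = 1"
    by (rule fps_ext) (simp add: word_gf_run_wt_nth)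
  finally have PN: "P * N = 1" .
  have PR: "P * R = G * N"
    by (simp add: P_def R_def G_def N_def word_gf_altc[symmetric] word_gf_gc[symmetric] mult inv
        conv_altc_ind_1[abs_def])
  have PU: "P * U = K * N"
    by (simp add: P_def U_def K_def G_def N_def word_gf_uc[symmetric])
      (simp add: word_gf_altc[symmetric] mult inv conv_altc_adj_ind[abs_def])
  have PT: "P * T = G * R + H * N"
    by (simp add: P_def R_def G_def N_def H_def T_def word_gf_altc[symmetric] word_gf_gc[symmetric]
        word_gf_hc[symmetric] mult inv word_gf_add[symmetric] conv_altc_ind_2[abs_def])
  have P0: "P $ 0 = 1"
    by (simp add: P_def P_ser_def)
  \<comment> \<open>Over a field, power series have no zero divisors, so a nonzero power of
    \<open>P\<close> cancels in the division.\<close>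
  have quot: "A = B / P ^ m" if "P ^ m * A = B" for A B m
  proof -
    have "P ^ m \<noteq> 0"
      using P0 by (metis fps_zero_nth power_eq_0_iff zero_neq_one)
    then show ?thesis
      using that by (metis nonzero_mult_div_cancel_left)
  qed
  \<comment> \<open>\<open>N\<close> is the inverse of \<open>P\<close>: one factor \<open>P\<close>
    serves the recurrence and another clears \<open>N\<close>. For \<open>T\<close> a third factor
    is needed, as its recurrence involves \<open>R\<close>.\<close>
  have "P ^ 2 * U = P * (P * U)" by (simp add: power2_eq_square mult.assoc)
  also have "\<dots> = K * (P * N)" by (simp add: PU mult_ac)
  finally have U2: "P ^ 2 * U = K" by (simp add: PN)
  have R2: "P * (P * R) = G"
    using PN by (simp add: PR mult.left_commute)
  have "P ^ 3 * T = P * (P * (G * R + H * N))"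
    by (simp add: PT[symmetric] power3_eq_cube mult.assoc)
  also have "\<dots> = G * (P * (P * R)) + P * H * (P * N)"
    by (simp add: algebra_simps)
  finally have T3: "P ^ 3 * T = G ^ 2 + P * H"
    by (simp add: R2 PN power2_eq_square)
  have "P ^ 3 * (T - U) = P ^ 3 * T - P * (P ^ 2 * U)"
    by (simp add: algebra_simps power2_eq_square power3_eq_cube)
  also have "\<dots> = G ^ 2 + P * (H + G - (fps_const (r_num k r) * fps_X - 1) - P)"
    by (simp only: T3 U2) (simp add: K_def algebra_simps)
  finally have V3: "P ^ 3 * (T - U) = \<dots>" .
  have gU: "gen_fun p q r (\<lambda>n. U_set n k) = U"
    unfolding U_def adj_ind_def[abs_def] by (rule gen_fun_eq_word_gf) (rule U_set_eq)
  have "gen_fun p q r (\<lambda>n. V_set n k) =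
      ?gf (\<lambda>l. of_bool (card (rises l) = 2 \<and> \<not> (\<exists>s. rises l = {s, Suc s})))"
    by (rule gen_fun_eq_word_gf) (rule V_set_eq)
  \<comment> \<open>Two adjacent positions form a set of size 2, so the indicator is a
    difference.\<close>
  also have "(\<lambda>l. of_bool (card (rises l) = 2 \<and> \<not> (\<exists>s. rises l = {s, Suc s}))) =
      (\<lambda>l. rises_ind 2 l - adj_ind l :: 'a)"
    by (auto simp: rises_ind_def adj_ind_def fun_eq_iff)
  also have "?gf \<dots> = T - U"
    by (simp add: word_gf_diff T_def U_def)
  finally have gV: "gen_fun p q r (\<lambda>n. V_set n k) = T - U" .
  show ?thesis
    unfolding gU gV P_def[symmetric] G_def[symmetric] H_def[symmetric]
    using quot[OF U2] quot[OF V3] by (simp add: K_def)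
qed

end
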